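(* Suppose that for every $v_i\in\mathcal V$ the function $f_i:\mathbb R^d\to\mathbb R$ is differentiable, $\mu_i$-strongly convex and has $L_i$-Lipschitz gradient, with $\mu_i,L_i>0$. Let $A$ be an algorithm in the framework REDGRAF that satisfies the $(\boldsymbol x_{\mathrm c},\gamma,\{c[k]\})$-states contraction property and the reduction property of Type-II (so $\alpha_k=\alpha$ is constant). Let $\beta=\sqrt{1-\alpha\tilde\mu}$ and $$R^*:=\frac{r_{\mathrm c}\sqrt{\alpha\tilde L}}{1-\beta\sqrt\gamma}.$$ If $c[k]=O(\xi^k)$ for some $\xi\in(0,1)\setminus\{\beta\sqrt\gamma\}$, then for all $v_i\in\mathcal V_{\mathcal R}$ $$\|\boldsymbol x_i[k]-\boldsymbol x^*\|\le 2R^*+O\big((\max\{\beta\sqrt\gamma,\ \xi\})^k\big),$$ where $\boldsymbol x^*$ is the minimizer of $f(\boldsymbol x)=\frac1{|\mathcal V_{\mathcal R}|}\sum_{v_i\in\mathcal V_{\mathcal R}}f_i(\boldsymbol x)$.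
   Context: Framework. $\mathcal G=(\mathcal V,\mathcal E)$ is a directed graph on agents $\mathcal V=\{v_1,\dots,v_N\}$, partitioned into a nonempty set $\mathcal V_{\mathcal R}$ of regular agents and a set $\mathcal V_{\mathcal B}$ of Byzantine agents. Agent $v_i$ has a local function $f_i:\mathbb R^d\to\mathbb R$. An algorithm in REDGRAF works as follows. Each regular agent $v_i$ keeps a state $\boldsymbol x_i[k]\in\mathbb R^d$ and optionally an auxiliary vector $\boldsymbol y_i[k]$, initialized by an algorithm-specific rule. At each time $k\in\mathbb N=\{0,1,\dots\}$ it sends them to its out-neighbors, receives the corresponding vectors from its in-neighbors (Byzantine agents may send arbitrary vectors), computes by an algorithm-specific filtering procedure an intermediate state $\tilde{\boldsymbol x}_i[k]\in\mathbb R^d$ (and $\tilde{\boldsymbol y}_i[k]$), and sets $\boldsymbol x_i[k+1]=\tilde{\boldsymbol x}_i[k]-\alpha_k\nabla f_i(\tilde{\boldsymbol x}_i[k])$ (and $\boldsymbol y_i[k+1]=\tilde{\boldsymbol y}_i[k]$), where $\alpha_k>0$ is the step-size. Properties of an algorithm are properties of the sequences it generates in the execution under consideration. Functions. $f$ is $\mu$-strongly convex if $f(\boldsymbol x_1)\ge f(\boldsymbol x_2)+\langle\nabla f(\boldsymbol x_2),\boldsymbol x_1-\boldsymbol x_2\rangle+\frac\mu2\|\boldsymbol x_1-\boldsymbol x_2\|^2$ for all $\boldsymbol x_1,\boldsymbol x_2$. $\|\cdot\|$ is the Euclidean norm. $\tilde L:=\max_{v_i\in\mathcal V_{\mathcal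 R}}L_i$, $\tilde\mu:=\min_{v_i\in\mathcal V_{\mathcal R}}\mu_i$, and $\boldsymbol x_i^*$ is the minimizer of $f_i$. States contraction. For $\boldsymbol x_{\mathrm c}\in\mathbb R^d$, $\gamma\ge0$ and a real sequence $\{c[k]\}_{k\in\mathbb N}$, the $(\boldsymbol x_{\mathrm c},\gamma,\{c[k]\})$-states contraction property means: $\lim_{k\to\infty}c[k]=0$ and for all $k\in\mathbb N$, $v_i\in\mathcal V_{\mathcal R}$, $\|\tilde{\boldsymbol x}_i[k]-\boldsymbol x_{\mathrm c}\|\le\sqrt\gamma\max_{v_j\in\mathcal V_{\mathcal R}}\|\boldsymbol x_j[k]-\boldsymbol x_{\mathrm c}\|+c[k]$. Put $r_{\mathrm c}:=\max_{v_i\in\mathcal V_{\mathcal R}}\|\boldsymbol x_{\mathrm c}-\boldsymbol x_i^*\|$. Reduction property of Type-II: the states contraction property holds with $\gamma\in\Big[1,\frac1{1-\tilde\mu/\tilde L}\Big)$ and $\alpha_k=\alpha\in\Big(\frac1{\tilde\mu}\big(1-\frac1\gamma\big),\frac1{\tilde L}\Big]$ for all $k$ (the upper endpoint for $\gamma$ is read as $+\infty$ if $\tilde\mu=\tilde L$). $O(\cdot)$ is with respect to $k$: $a[k]=O(b[k])$ means $|a[k]|\le C\,b[k]$ for all $k$ and some constant $C$ independent of $k$. *)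

theory Defs
  imports "HOL-Analysis.Analysis" "Graph_Theory.Pair_Digraph"
begin

section \<open>Functions\<close>

definition gradient :: "('a::euclidean_space \<Rightarrow> real) \<Rightarrow> 'a \<Rightarrow> 'a" where
  "gradient f x = (THE D. GDERIV f x :> D)"

lemma gradient_eqI:
  assumes "GDERIV f x :> D"
  shows "gradient f x = D"
  unfolding gradient_def
proof (rule the_equality)
  show "GDERIV f x :> D" by (rule assms)
next
  fix D' assume "GDERIV f x :> D'"
  with assms have "(\<lambda>h. inner h D') = (\<lambda>h. inner h D)"
    unfolding gderiv_def by (metis has_derivative_unique)
  then show "D' = D"
    by (metis inner_commute vector_eq_rdot)
qed

lemma GDERIV_gradient:
  fixes f :: "'a::euclidean_space \<Rightarrow> real"
  assumes "f differentiable (at x)"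
  shows "GDERIV f x :> gradient f x"
proof -
  obtain f' where f': "(f has_derivative f') (at x)"
    using assms by (auto simp: differentiable_def)
  then interpret f': bounded_linear f' by (rule has_derivative_bounded_linear)
  have "f' = (\<lambda>h. inner h (adjoint f' 1))"
    using adjoint_works[OF f'.linear, of _ 1] by (auto simp: fun_eq_iff)
  with f' have "GDERIV f x :> adjoint f' 1"
    unfolding gderiv_def by metis
  then show ?thesis using gradient_eqI by metis
qed

definition strongly_convex :: "real \<Rightarrow> ('a::euclidean_space \<Rightarrow> real) \<Rightarrow> bool" where
  "strongly_convex \<mu> f \<longleftrightarrow>
     (\<forall>x1 x2. f x1 \<ge> f x2 + inner (gradient f x2) (x1 - x2) + \<mu> / 2 * (norm (x1 - x2))\<^sup>2)"

text \<open>A differentiable \<open>\<mu>\<close>-strongly convex function with \<open>\<mu> > 0\<close> has exactly one minimizer,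
  which is then the value selected here.\<close>
definition minimizer :: "('a \<Rightarrow> real) \<Rightarrow> 'a" where
  "minimizer f = arg_min f (\<lambda>_. True)"

text \<open>The bound is required for all \<open>k\<close>, not only eventually as in the Landau symbols of the
  library.\<close>
definition big_O_seq :: "(nat \<Rightarrow> real) \<Rightarrow> (nat \<Rightarrow> real) \<Rightarrow> bool" where
  "big_O_seq a b \<longleftrightarrow> (\<exists>C. \<forall>k. \<bar>a k\<bar> \<le> C * b k)"

section \<open>The framework REDGRAF\<close>

locale network = pair_fin_digraph G
  for G :: "'v pair_pre_digraph" +
  fixes regular byzantine :: "'v set"
  assumes regular_nonempty: "regular \<noteq> {}"
    and agents: "regular \<union> byzantine = pverts G"
    and disjoint: "regular \<inter> byzantine = {}"

text \<open>What an agent keeps and sends: a state and, optionally, an auxiliary vector.\<close>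
type_synonym ('d, 'e) agent_data = "(real ^ 'd) \<times> (real ^ 'e) option"

text \<open>\<open>initial A i\<close> is the set of data with which agent \<open>i\<close> may start, and
  \<open>filtering A k i p m\<close> the set of intermediate data which it may compute at time \<open>k\<close> from its
  own data \<open>p\<close> and the messages \<open>m\<close> received from its in-neighbors (\<open>m j = None\<close> if \<open>j\<close> is not
  an in-neighbor). Sets allow for nondeterministic and randomized rules. The rules may use
  the local function and the position of agent \<open>i\<close>, since these are fixed before the algorithm.\<close>
record ('v, 'd, 'e) redgraf_algorithm =
  initial :: "'v \<Rightarrow> ('d, 'e) agent_data set"
  filtering :: "nat \<Rightarrow> 'v \<Rightarrow> ('d, 'e) agent_data \<Rightarrow> ('v \<Rightarrow> ('d, 'e) agent_data option)
    \<Rightarrow> ('d, 'e) agent_data set"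
  step_size :: "nat \<Rightarrow> real"

text \<open>\<open>sent k j i\<close> is the message from \<open>j\<close> to \<open>i\<close> at time \<open>k\<close>. It is unconstrained for Byzantine
  \<open>j\<close>, which may thus send different messages to different out-neighbors. The sequences
  \<open>x\<close>, \<open>y\<close>, \<open>xt\<close>, \<open>yt\<close> (with \<open>xt\<close>, \<open>yt\<close> the intermediate data) have arguments time and agent,
  and only their values at regular agents matter.\<close>
locale redgraf_execution = network G regular byzantine
  for G :: "'v pair_pre_digraph" and regular byzantine :: "'v set" +
  fixes f :: "'v \<Rightarrow> real ^ 'd::finite \<Rightarrow> real"
    and A :: "('v, 'd::finite, 'e::finite) redgraf_algorithm"
    and sent :: "nat \<Rightarrow> 'v \<Rightarrow> 'v \<Rightarrow> ('d, 'e) agent_data"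
    and x xt :: "nat \<Rightarrow> 'v \<Rightarrow> real ^ 'd"
    and y yt :: "nat \<Rightarrow> 'v \<Rightarrow> (real ^ 'e) option"
  assumes step_size_pos: "step_size A k > 0"
    and initialization: "i \<in> regular \<Longrightarrow> (x 0 i, y 0 i) \<in> initial A i"
    and transmission: "\<lbrakk>j \<in> regular; (j, i) \<in> parcs G\<rbrakk> \<Longrightarrow> sent k j i = (x k j, y k j)"
    and filtering_step: "i \<in> regular \<Longrightarrow> (xt k i, yt k i) \<in> filtering A k i (x k i, y k i)
          (\<lambda>j. if (j, i) \<in> parcs G then Some (sent k j i) else None)"
    and gradient_step: "i \<in> regular \<Longrightarrow>
          x (Suc k) i = xt k i - step_size A k *\<^sub>R gradient (f i) (xt k i)"
    and auxiliary_step: "i \<in> regular \<Longrightarrow> y (Suc k) i = yt k i"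

section \<open>Properties of the generated sequences\<close>

definition states_contraction ::
  "'v set \<Rightarrow> (nat \<Rightarrow> 'v \<Rightarrow> real ^ 'd) \<Rightarrow> (nat \<Rightarrow> 'v \<Rightarrow> real ^ 'd)
    \<Rightarrow> real ^ 'd \<Rightarrow> real \<Rightarrow> (nat \<Rightarrow> real) \<Rightarrow> bool" where
  "states_contraction regular x xt xc \<gamma> c \<longleftrightarrow>
     \<gamma> \<ge> 0 \<and> c \<longlonglongrightarrow> 0 \<and>
     (\<forall>k. \<forall>i\<in>regular. norm (xt k i - xc) \<le> sqrt \<gamma> * (MAX j\<in>regular. norm (x k j - xc)) + c k)"

definition L_tilde :: "'v set \<Rightarrow> ('v \<Rightarrow> real) \<Rightarrow> real" where
  "L_tilde regular L = (MAX i\<in>regular. L i)"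

definition mu_tilde :: "'v set \<Rightarrow> ('v \<Rightarrow> real) \<Rightarrow> real" where
  "mu_tilde regular \<mu> = (MIN i\<in>regular. \<mu> i)"

definition contraction_radius :: "'v set \<Rightarrow> ('v \<Rightarrow> real ^ 'd \<Rightarrow> real) \<Rightarrow> real ^ 'd \<Rightarrow> real" where
  "contraction_radius regular f xc = (MAX i\<in>regular. norm (xc - minimizer (f i)))"

text \<open>If \<open>mu_tilde regular \<mu> = L_tilde regular L\<close>, the upper bound on \<open>\<gamma>\<close> is infinite; it is then
  dropped, as division by zero would give the value \<open>0\<close>.\<close>
definition reduction_type_II ::
  "'v set \<Rightarrow> ('v \<Rightarrow> real) \<Rightarrow> ('v \<Rightarrow> real) \<Rightarrow> (nat \<Rightarrow> real)
    \<Rightarrow> (nat \<Rightarrow> 'v \<Rightarrow> real ^ 'd) \<Rightarrow> (nat \<Rightarrow> 'v \<Rightarrow> real ^ 'd)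
    \<Rightarrow> real ^ 'd \<Rightarrow> real \<Rightarrow> (nat \<Rightarrow> real) \<Rightarrow> real \<Rightarrow> bool" where
  "reduction_type_II regular \<mu> L steps x xt xc \<gamma> c \<alpha> \<longleftrightarrow>
     states_contraction regular x xt xc \<gamma> c \<and>
     1 \<le> \<gamma> \<and>
     (mu_tilde regular \<mu> \<noteq> L_tilde regular L \<longrightarrow>
        \<gamma> < 1 / (1 - mu_tilde regular \<mu> / L_tilde regular L)) \<and>
     (\<forall>k. steps k = \<alpha>) \<and>
     1 / mu_tilde regular \<mu> * (1 - 1 / \<gamma>) < \<alpha> \<and> \<alpha> \<le> 1 / L_tilde regular L"

end

theory Submission
  imports Defs
begin

text \<open>Combining strong convexity with the descent lemma shows that a gradient step of size
  \<open>\<alpha> \<le> 1 / L\<close> moves \<open>z\<close> to within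
  \<open>sqrt (1 - \<alpha> * \<mu>) * dist z xc + sqrt (\<alpha> * L) * dist xc x\<^sub>i\<^sup>*\<close> of \<open>xc\<close>. Together with the states
  contraction, the largest distance of a regular state from \<open>xc\<close> satisfies a linear recursion with
  rate \<open>\<beta> * sqrt \<gamma>\<close> and fixed point \<open>R_star\<close>. Moreover \<open>x\<^sup>*\<close> is the average of its own images under
  the local gradient steps, so the same estimate gives \<open>dist x\<^sup>* xc \<le> R_star\<close>; this is the second
  \<open>R_star\<close> of the bound.\<close>

section \<open>Strongly convex functions with Lipschitz gradient\<close>

lemma has_derivative_gradient:
  fixes f :: "'a::euclidean_space \<Rightarrow> real"
  assumes "f differentiable (at z)"
  shows "(f has_derivative (\<lambda>h. inner h (gradient f z))) (at z)"
  using GDERIV_gradient[OF assms] by (simp add: gderiv_def)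

lemma gradient_eq_0_at_min:
  fixes f :: "'a::euclidean_space \<Rightarrow> real"
  assumes "f differentiable (at z)" and "\<And>w. f z \<le> f w"
  shows "gradient f z = 0"
proof -
  have "(\<lambda>h. inner h (gradient f z)) = (\<lambda>h. 0)"
    by (rule differential_zero_maxmin[OF _ open_UNIV has_derivative_gradient[OF assms(1)]])
       (use assms(2) in auto)
  then show ?thesis
    by (metis inner_eq_zero_iff)
qed

text \<open>Lets all regular agents share the smallest of their convexity constants.\<close>

lemma strongly_convex_mono:
  assumes "strongly_convex \<mu> f" and "\<nu> \<le> \<mu>"
  shows "strongly_convex \<nu> f"
  unfolding strongly_convex_def
proof (intro allI)
  fix z w :: 'a
  have "\<nu> / 2 * (norm (z - w))\<^sup>2 \<le> \<mu> / 2 * (norm (z - w))\<^sup>2"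
    using assms(2) by (intro mult_right_mono) auto
  moreover have "f z \<ge> f w + inner (gradient f w) (z - w) + \<mu> / 2 * (norm (z - w))\<^sup>2"
    using assms(1) unfolding strongly_convex_def by blast
  ultimately show "f z \<ge> f w + inner (gradient f w) (z - w) + \<nu> / 2 * (norm (z - w))\<^sup>2"
    by linarith
qed

text \<open>The form with \<open>GDERIV\<close> yields both the differentiability of the average and
  the value of its gradient.\<close>

lemma gradient_average:
  fixes f :: "'v \<Rightarrow> 'a::euclidean_space \<Rightarrow> real"
  assumes "\<And>i. i \<in> S \<Longrightarrow> f i differentiable (at z)"
  shows "GDERIV (\<lambda>z. 1 / real (card S) * (\<Sum>i\<in>S. f i z)) z
           :> (1 / real (card S)) *\<^sub>R (\<Sum>i\<in>S. gradient (f i) z)"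
proof -
  have "((\<lambda>z. 1 / real (card S) * (\<Sum>i\<in>S. f i z)) has_derivative
          (\<lambda>h. 1 / real (card S) * (\<Sum>i\<in>S. inner h (gradient (f i) z)))) (at z)"
    by (intro has_derivative_mult_right has_derivative_sum has_derivative_gradient assms)
  then show ?thesis
    by (simp add: gderiv_def inner_sum_right)
qed

lemma strongly_convex_average:
  fixes f :: "'v \<Rightarrow> 'a::euclidean_space \<Rightarrow> real"
  assumes S: "finite S" "S \<noteq> {}"
    and diff: "\<And>i z. i \<in> S \<Longrightarrow> f i differentiable (at z)"
    and sc: "\<And>i. i \<in> S \<Longrightarrow> strongly_convex \<mu> (f i)"
  shows "strongly_convex \<mu> (\<lambda>z. 1 / real (card S) * (\<Sum>i\<in>S. f i z))"
  unfolding strongly_convex_def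
proof (intro allI)
  fix z w :: 'a
  let ?n = "real (card S)"
  have grad: "gradient (\<lambda>z. 1 / ?n * (\<Sum>i\<in>S. f i z)) w = (1 / ?n) *\<^sub>R (\<Sum>i\<in>S. gradient (f i) w)"
    by (intro gradient_eqI gradient_average diff)
  have n: "?n > 0"
    using S by (simp add: card_gt_0_iff)
  have "(\<Sum>i\<in>S. f i w + inner (gradient (f i) w) (z - w) + \<mu> / 2 * (norm (z - w))\<^sup>2)
      \<le> (\<Sum>i\<in>S. f i z)"
    using sc unfolding strongly_convex_def by (intro sum_mono) blast
  then have "1 / ?n * ((\<Sum>i\<in>S. f i w) + (\<Sum>i\<in>S. inner (gradient (f i) w) (z - w))
        + ?n * (\<mu> / 2 * (norm (z - w))\<^sup>2)) \<le> 1 / ?n * (\<Sum>i\<in>S. f i z)"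
    using n by (intro mult_left_mono) (auto simp: sum.distrib)
  then show "1 / ?n * (\<Sum>i\<in>S. f i z) \<ge> 1 / ?n * (\<Sum>i\<in>S. f i w)
      + inner (gradient (\<lambda>z. 1 / ?n * (\<Sum>i\<in>S. f i z)) w) (z - w) + \<mu> / 2 * (norm (z - w))\<^sup>2"
    unfolding grad using n by (simp add: distrib_left inner_sum_left)
qed

text \<open>\<open>minimizer\<close> is a Hilbert choice, so a minimizer must first be shown to
  exist. Quadratic growth confines the search to a compact ball, where continuity provides
  one.\<close>

lemma strongly_convex_minimizer:
  fixes f :: "'a::euclidean_space \<Rightarrow> real"
  assumes diff: "\<And>z. f differentiable (at z)" and sc: "strongly_convex \<mu> f" and "\<mu> > 0"
  shows "f (minimizer f) \<le> f z"
proof -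
  \<comment> \<open>Outside this radius \<open>\<mu> / 2 * norm z\<close> is at least
    \<open>norm (gradient f 0)\<close>, so the quadratic term at 0 absorbs the linear one and
    \<open>f z\<close> is at least \<open>f 0\<close>.\<close>
  define r where "r = 2 * norm (gradient f 0) / \<mu>"
  have "r \<ge> 0"
    using \<open>\<mu> > 0\<close> by (simp add: r_def)
  have "continuous_on (cball 0 r) f"
    using diff by (intro continuous_at_imp_continuous_on ballI differentiable_imp_continuous_within)
  then obtain m where m: "\<And>z. z \<in> cball 0 r \<Longrightarrow> f m \<le> f z"
    using continuous_attains_inf[OF compact_cball, of 0 r f] \<open>r \<ge> 0\<close> by (metis cball_eq_empty not_le)
  have "f m \<le> f z" for z
  proof (cases "z \<in> cball 0 r")
    case False
    then have "2 * norm (gradient f 0) \<le> \<mu> * norm z"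
      using \<open>\<mu> > 0\<close> by (simp add: r_def field_simps)
    then have "norm (gradient f 0) * norm z \<le> (\<mu> / 2 * norm z) * norm z"
      by (intro mult_right_mono) auto
    moreover have "- inner (gradient f 0) z \<le> norm (gradient f 0) * norm z"
      using Cauchy_Schwarz_ineq2[of "gradient f 0" z] by linarith
    moreover have "f z \<ge> f 0 + inner (gradient f 0) (z - 0) + \<mu> / 2 * (norm (z - 0))\<^sup>2"
      using sc unfolding strongly_convex_def by blast
    ultimately have "f 0 \<le> f z"
      by (simp add: power2_eq_square)
    moreover have "f m \<le> f 0"
      using m[of 0] \<open>r \<ge> 0\<close> by simp
    ultimately show ?thesis
      by simp
  qed (rule m)
  then have "is_arg_min f (\<lambda>_. True) m"
    by (auto simp: is_arg_min_linorder)
  then have "is_arg_min f (\<lambda>_. True) (minimizer f)"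
    unfolding minimizer_def arg_min_def by (rule someI)
  then show ?thesis
    by (auto simp: is_arg_min_linorder)
qed

text \<open>On the segment from \<open>z\<close> to \<open>w\<close>, subtract from \<open>f\<close>
  its linear part and the quadratic term. By Cauchy-Schwarz and the Lipschitz bound the difference
  \<open>\<phi>\<close> has nonpositive derivative on [0, 1].\<close>

lemma descent_lemma:
  fixes f :: "'a::euclidean_space \<Rightarrow> real"
  assumes diff: "\<And>z. f differentiable (at z)"
    and lip: "L-lipschitz_on UNIV (gradient f)"
  shows "f w \<le> f z + inner (gradient f z) (w - z) + L / 2 * (norm (w - z))\<^sup>2"
proof -
  define d where "d = w - z"
  define \<phi> where "\<phi> t = f (z + t *\<^sub>R d) - t * inner (gradient f z) d - L / 2 * t\<^sup>2 * (norm d)\<^sup>2" for t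
  have der: "(\<phi> has_real_derivative
      (inner (gradient f (z + t *\<^sub>R d) - gradient f z) d - L * t * (norm d)\<^sup>2)) (at t)" for t
  proof -
    have "((\<lambda>t. f (z + t *\<^sub>R d)) has_derivative
        (\<lambda>h. inner (h *\<^sub>R d) (gradient f (z + t *\<^sub>R d)))) (at t)"
      by (rule has_derivative_compose[where g = f and f = "\<lambda>t. z + t *\<^sub>R d",
            OF _ has_derivative_gradient[OF diff]])
         (auto intro!: derivative_eq_intros)
    then have "((\<lambda>t. f (z + t *\<^sub>R d)) has_real_derivative inner (gradient f (z + t *\<^sub>R d)) d) (at t)"
      by (simp add: has_field_derivative_def inner_commute mult_commute_abs)
    then show ?thesis
      unfolding \<phi>_def by (auto intro!: derivative_eq_intros simp: algebra_simps)
  qed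
  have "\<phi> 1 \<le> \<phi> 0"
  proof (rule DERIV_nonpos_imp_nonincreasing[where f = \<phi>])
    fix t :: real
    assume t: "0 \<le> t" "t \<le> 1"
    have "inner (gradient f (z + t *\<^sub>R d) - gradient f z) d
        \<le> norm (gradient f (z + t *\<^sub>R d) - gradient f z) * norm d"
      by (rule norm_cauchy_schwarz)
    also have "\<dots> \<le> (L * norm (t *\<^sub>R d)) * norm d"
      using lipschitz_onD[OF lip, of "z + t *\<^sub>R d" z] by (intro mult_right_mono) (auto simp: dist_norm)
    also have "\<dots> = L * t * (norm d)\<^sup>2"
      using t by (simp add: power2_eq_square)
    finally show "\<exists>y. (\<phi> has_real_derivative y) (at t) \<and> y \<le> 0"
      using der[of t] by auto
  qed simp
  then show ?thesis
    by (simp add: \<phi>_def d_def)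
qed

text \<open>A gradient step of size 1 / L lowers \<open>f\<close> by at least the squared gradient
  norm over 2 L, but never below the minimum.\<close>

lemma norm_gradient_le:
  fixes f :: "'a::euclidean_space \<Rightarrow> real"
  assumes diff: "\<And>z. f differentiable (at z)"
    and lip: "L-lipschitz_on UNIV (gradient f)" and "L > 0"
    and min: "\<And>z. f m \<le> f z"
  shows "(norm (gradient f z))\<^sup>2 \<le> 2 * L * (f z - f m)"
proof -
  have "f m \<le> f (z - (1 / L) *\<^sub>R gradient f z)"
    by (rule min)
  also have "\<dots> \<le> f z - 1 / L * (norm (gradient f z))\<^sup>2 + L / 2 * (1 / L * norm (gradient f z))\<^sup>2"
    using descent_lemma[OF diff lip, of "z - (1 / L) *\<^sub>R gradient f z" z] \<open>L > 0\<close>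
    by (simp add: power2_norm_eq_inner)
  also have "\<dots> = f z - (norm (gradient f z))\<^sup>2 / (2 * L)"
    using \<open>L > 0\<close> by (simp add: field_simps power2_eq_square)
  finally show ?thesis
    using \<open>L > 0\<close> by (simp add: field_simps)
qed

text \<open>The quadratic lower and upper bounds at 0 are compared at a unit vector. This keeps the
  radicand \<open>1 - \<alpha> * \<mu>\<close> nonnegative.\<close>

lemma strongly_convex_le_lipschitz:
  fixes f :: "'a::euclidean_space \<Rightarrow> real"
  assumes diff: "\<And>z. f differentiable (at z)"
    and sc: "strongly_convex \<mu> f" and lip: "L-lipschitz_on UNIV (gradient f)"
  shows "\<mu> \<le> L"
proof -
  obtain b :: 'a where b: "norm b = 1"
    using vector_choose_size[of 1] by auto
  have "f b \<ge> f 0 + inner (gradient f 0) (b - 0) + \<mu> / 2 * (norm (b - 0))\<^sup>2"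
    using sc unfolding strongly_convex_def by blast
  with descent_lemma[OF diff lip, of b 0] b show ?thesis
    by simp
qed

text \<open>In the expanded square, strong convexity bounds the inner product and
  \<open>norm_gradient_le\<close> the squared gradient. What remains is a multiple of
  \<open>f p - f m\<close>, which the descent lemma at \<open>m\<close> controls because the
  gradient vanishes there.\<close>

lemma gradient_step_bound:
  fixes f :: "'a::euclidean_space \<Rightarrow> real"
  assumes diff: "\<And>z. f differentiable (at z)"
    and sc: "strongly_convex \<mu> f" and lip: "L-lipschitz_on UNIV (gradient f)"
    and "L > 0" and \<alpha>: "0 \<le> \<alpha>" "\<alpha> * L \<le> 1"
    and min: "\<And>z. f m \<le> f z"
  shows "norm (z - \<alpha> *\<^sub>R gradient f z - p)
    \<le> sqrt (1 - \<alpha> * \<mu>) * norm (z - p) + sqrt (\<alpha> * L) * norm (p - m)"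
proof -
  let ?g = "gradient f z"
  have "\<alpha> * \<mu> \<le> \<alpha> * L"
    using strongly_convex_le_lipschitz[OF diff sc lip] \<alpha> by (intro mult_left_mono)
  with \<alpha> have nonneg: "0 \<le> 1 - \<alpha> * \<mu>" "0 \<le> \<alpha> * L"
    using \<open>L > 0\<close> by auto
  have "f p \<ge> f z + inner ?g (p - z) + \<mu> / 2 * (norm (p - z))\<^sup>2"
    using sc unfolding strongly_convex_def by blast
  then have "2 * \<alpha> * (f z - f p + \<mu> / 2 * (norm (z - p))\<^sup>2) \<le> 2 * \<alpha> * inner ?g (z - p)"
    using \<alpha> by (intro mult_left_mono) (auto simp: inner_diff_right norm_minus_commute)
  moreover have "\<alpha>\<^sup>2 * (norm ?g)\<^sup>2 \<le> \<alpha>\<^sup>2 * (2 * L * (f z - f m))"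
    by (intro mult_left_mono norm_gradient_le diff lip \<open>L > 0\<close> min) auto
  \<comment> \<open>With the factor \<open>\<alpha> * L\<close> replaced by 1, \<open>f z\<close>
    cancels against the strong convexity bound.\<close>
  moreover have "2 * \<alpha> * (\<alpha> * L) * (f z - f m) \<le> 2 * \<alpha> * 1 * (f z - f m)"
    using \<alpha> min[of z] by (intro mult_right_mono mult_left_mono) auto
  moreover have "2 * \<alpha> * (f p - f m) \<le> 2 * \<alpha> * (L / 2 * (norm (p - m))\<^sup>2)"
    using descent_lemma[OF diff lip, of p m] gradient_eq_0_at_min[OF diff min] \<alpha>
    by (intro mult_left_mono) auto
  moreover have "(norm (z - \<alpha> *\<^sub>R ?g - p))\<^sup>2
      = (norm (z - p))\<^sup>2 - 2 * \<alpha> * inner ?g (z - p) + \<alpha>\<^sup>2 * (norm ?g)\<^sup>2"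
    unfolding power2_norm_eq_inner
    by (simp add: inner_diff_left inner_diff_right inner_commute algebra_simps power2_eq_square)
  ultimately have "(norm (z - \<alpha> *\<^sub>R ?g - p))\<^sup>2
      \<le> (1 - \<alpha> * \<mu>) * (norm (z - p))\<^sup>2 + \<alpha> * L * (norm (p - m))\<^sup>2"
    by (simp add: algebra_simps power2_eq_square)
  also have "\<dots> = (sqrt (1 - \<alpha> * \<mu>) * norm (z - p))\<^sup>2 + (sqrt (\<alpha> * L) * norm (p - m))\<^sup>2"
    using nonneg by (simp add: power_mult_distrib)
  also have "\<dots> \<le> (sqrt (1 - \<alpha> * \<mu>) * norm (z - p) + sqrt (\<alpha> * L) * norm (p - m))\<^sup>2"
    using nonneg by (simp add: power2_sum)
  finally show ?thesis
    by (rule power2_le_imp_le) (use nonneg in simp)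
qed

section \<open>A perturbed linear recursion\<close>

text \<open>Induction compares \<open>a\<close> with the explicit solution of the recursion with
  equality. The resonant case \<open>\<xi> = \<rho>\<close> is excluded, as its particular solution
  carries an extra factor k.\<close>

lemma perturbed_recursion_bound:
  fixes a :: "nat \<Rightarrow> real"
  assumes rec: "\<And>k. a (Suc k) \<le> \<rho> * a k + B * \<xi> ^ k + (1 - \<rho>) * R"
    and \<rho>: "0 \<le> \<rho>" and \<xi>: "0 \<le> \<xi>" "\<xi> \<noteq> \<rho>"
  obtains D where "\<And>k. a k \<le> R + D * max \<rho> \<xi> ^ k"
proof
  \<comment> \<open>\<open>E * \<xi> ^ k\<close> is a particular solution of \<open>e (Suc k) = \<rho> * e k + B * \<xi> ^ k\<close>, whatever the sign of
    \<open>\<xi> - \<rho>\<close>.\<close>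
  define E where "E = B / (\<xi> - \<rho>)"
  \<comment> \<open>Makes the bound below an equality at k = 0.\<close>
  define F where "F = a 0 - R - E"
  have E: "B = (\<xi> - \<rho>) * E"
    using \<xi> by (simp add: E_def)
  fix k
  have "a k \<le> R + F * \<rho> ^ k + E * \<xi> ^ k"
  proof (induction k)
    case (Suc k)
    have "a (Suc k) \<le> \<rho> * (R + F * \<rho> ^ k + E * \<xi> ^ k) + B * \<xi> ^ k + (1 - \<rho>) * R"
      using rec[of k] mult_left_mono[OF Suc.IH \<rho>] by linarith
    then show ?case
      by (simp add: E algebra_simps)
  qed (simp add: F_def)
  \<comment> \<open>\<open>E\<close> is negative if B > 0 and \<open>\<xi> < \<rho>\<close>, and
    \<open>F\<close> may be negative too, hence the absolute values.\<close>
  moreover have "F * \<rho> ^ k \<le> \<bar>F\<bar> * max \<rho> \<xi> ^ k" "E * \<xi> ^ k \<le> \<bar>E\<bar> * max \<rho> \<xi> ^ k"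
    using \<rho> \<xi> by (intro mult_mono power_mono; simp)+
  ultimately show "a k \<le> R + (\<bar>F\<bar> + \<bar>E\<bar>) * max \<rho> \<xi> ^ k"
    by (simp add: distrib_right)
qed

section \<open>Convergence of the regular states\<close>

theorem theorem5p8:
  fixes G :: "'v pair_pre_digraph" and regular byzantine :: "'v set"
    and f :: "'v \<Rightarrow> real ^ 'd \<Rightarrow> real"
    and \<mu> L :: "'v \<Rightarrow> real"
    and A :: "('v, 'd::finite, 'e::finite) redgraf_algorithm"
    and sent :: "nat \<Rightarrow> 'v \<Rightarrow> 'v \<Rightarrow> ('d, 'e) agent_data"
    and x xt :: "nat \<Rightarrow> 'v \<Rightarrow> real ^ 'd"
    and y yt :: "nat \<Rightarrow> 'v \<Rightarrow> (real ^ 'e) option"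
    and xc :: "real ^ 'd" and \<gamma> \<alpha> \<xi> \<beta> R_star :: real and c :: "nat \<Rightarrow> real"
  assumes local_functions: "\<And>i. i \<in> pverts G \<Longrightarrow>
        \<mu> i > 0 \<and> L i > 0 \<and> (\<forall>z. f i differentiable (at z)) \<and>
        strongly_convex (\<mu> i) (f i) \<and> (L i)-lipschitz_on UNIV (gradient (f i))"
    and execution: "redgraf_execution G regular byzantine f A sent x xt y yt"
    and contraction: "states_contraction regular x xt xc \<gamma> c"
    and reduction: "reduction_type_II regular \<mu> L (step_size A) x xt xc \<gamma> c \<alpha>"
    and beta: "\<beta> = sqrt (1 - \<alpha> * mu_tilde regular \<mu>)"
    and R_star: "R_star = contraction_radius regular f xc * sqrt (\<alpha> * L_tilde regular L)
          / (1 - \<beta> * sqrt \<gamma>)"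
    and xi: "\<xi> \<in> {0<..<1} - {\<beta> * sqrt \<gamma>}"
    and c_rate: "big_O_seq c (\<lambda>k. \<xi> ^ k)"
  shows "\<forall>i\<in>regular. \<exists>e. big_O_seq e (\<lambda>k. (max (\<beta> * sqrt \<gamma>) \<xi>) ^ k) \<and>
    (\<forall>k. norm (x k i - minimizer (\<lambda>z. 1 / real (card regular) * (\<Sum>j\<in>regular. f j z)))
        \<le> 2 * R_star + e k)"
proof -
  interpret redgraf_execution G regular byzantine f A sent x xt y yt
    by (rule execution)
  have fin: "finite regular"
    using agents finite_verts by (metis finite_Un)

  \<comment> \<open>Common constants and the contraction rate\<close>
  define m l where "m = mu_tilde regular \<mu>" and "l = L_tilde regular L"
  have m_le: "m \<le> \<mu> i" and le_l: "L i \<le> l" if "i \<in> regular" for i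
    using fin that by (auto simp: m_def l_def mu_tilde_def L_tilde_def)
  have loc: "\<mu> i > 0" "L i > 0" "f i differentiable (at z)"
      "strongly_convex (\<mu> i) (f i)" "(L i)-lipschitz_on UNIV (gradient (f i))"
    if "i \<in> regular" for i z
    using local_functions[of i] agents that by auto
  have sc: "strongly_convex m (f i)" and lip: "l-lipschitz_on UNIV (gradient (f i))"
    if "i \<in> regular" for i
    using strongly_convex_mono[OF loc(4) m_le] lipschitz_on_le[OF loc(5) le_l] that by auto
  have "m > 0"
    using loc(1) fin regular_nonempty by (auto simp: m_def mu_tilde_def)
  obtain i0 where i0: "i0 \<in> regular"
    using regular_nonempty by blast
  have "l > 0"
    using loc(2)[OF i0] le_l[OF i0] by linarith
  have "m \<le> l"
    by (rule strongly_convex_le_lipschitz[OF loc(3) sc lip]) (rule i0)+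

  have "1 \<le> \<gamma>" and step: "\<And>k. step_size A k = \<alpha>"
    and \<alpha>: "1 / m * (1 - 1 / \<gamma>) < \<alpha>" "\<alpha> * l \<le> 1"
    using reduction \<open>l > 0\<close>
    by (auto simp: reduction_type_II_def m_def l_def pos_le_divide_eq mult.commute)
  have "\<alpha> > 0"
    using step_size_pos[of 0] step by simp
  have "\<alpha> * m \<le> \<alpha> * l"
    using \<open>m \<le> l\<close> \<open>\<alpha> > 0\<close> by simp
  with \<alpha> have \<beta>: "\<beta> = sqrt (1 - \<alpha> * m)" "0 \<le> 1 - \<alpha> * m"
    by (auto simp: beta m_def)
  then have "\<beta> \<ge> 0"
    by simp
  define \<rho> where "\<rho> = \<beta> * sqrt \<gamma>"
  \<comment> \<open>The lower bound on the step size, rearranged: it says exactly that the square of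
    \<open>\<rho>\<close> is below 1.\<close>
  have "(1 - \<alpha> * m) * \<gamma> < 1"
    using \<alpha>(1) \<open>m > 0\<close> \<open>1 \<le> \<gamma>\<close> by (simp add: field_simps)
  then have "\<rho> < 1"
    using real_sqrt_lt_1_iff by (simp add: \<rho>_def \<beta> flip: real_sqrt_mult)
  have "\<beta> * 1 \<le> \<rho>"
    unfolding \<rho>_def using \<open>\<beta> \<ge> 0\<close> \<open>1 \<le> \<gamma>\<close> by (intro mult_left_mono) auto
  define r where "r = contraction_radius regular f xc * sqrt (\<alpha> * l)"
  have R: "(1 - \<rho>) * R_star = r"
    using \<open>\<rho> < 1\<close> by (simp add: R_star r_def l_def \<rho>_def)

  \<comment> \<open>A uniform bound for the local gradient steps\<close>
  have gstep: "norm (z - \<alpha> *\<^sub>R gradient (f i) z - xc) \<le> \<beta> * norm (z - xc) + r"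
    if i: "i \<in> regular" for i z
  proof -
    have min: "f i (minimizer (f i)) \<le> f i w" for w
      by (rule strongly_convex_minimizer[OF loc(3)[OF i] sc[OF i] \<open>m > 0\<close>])
    have "norm (z - \<alpha> *\<^sub>R gradient (f i) z - xc)
        \<le> \<beta> * norm (z - xc) + sqrt (\<alpha> * l) * norm (xc - minimizer (f i))"
      unfolding \<beta>(1) using \<open>\<alpha> > 0\<close> \<open>l > 0\<close> \<alpha>(2)
      by (intro gradient_step_bound loc(3)[OF i] sc[OF i] lip[OF i] min) auto
    also have "sqrt (\<alpha> * l) * norm (xc - minimizer (f i)) \<le> sqrt (\<alpha> * l) * contraction_radius regular f xc"
      unfolding contraction_radius_def using fin i \<open>\<alpha> > 0\<close> \<open>l > 0\<close> by (intro mult_left_mono Max_ge) auto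
    finally show ?thesis
      by (simp add: r_def mult.commute)
  qed

  \<comment> \<open>The recursion for the largest distance from \<open>xc\<close>\<close>
  define M where "M k = (MAX j\<in>regular. norm (x k j - xc))" for k
  have M_ge: "norm (x k i - xc) \<le> M k" if "i \<in> regular" for i k
    unfolding M_def using fin that by auto
  obtain C where C: "\<And>k. \<bar>c k\<bar> \<le> C * \<xi> ^ k"
    using c_rate by (auto simp: big_O_seq_def)
  \<comment> \<open>The perturbation \<open>c k\<close> enters before the gradient step, which
    scales it by \<open>\<beta>\<close>. The offset \<open>r\<close> is written as
    \<open>(1 - \<rho>) * R_star\<close> so that \<open>R_star\<close> is the fixed point.\<close>
  have rec: "M (Suc k) \<le> \<rho> * M k + \<beta> * C * \<xi> ^ k + (1 - \<rho>) * R_star" for k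
  proof -
    have "norm (x (Suc k) i - xc) \<le> \<rho> * M k + \<beta> * C * \<xi> ^ k + r" if i: "i \<in> regular" for i
    proof -
      have "norm (xt k i - xc) \<le> sqrt \<gamma> * M k + c k"
        using contraction i by (auto simp: states_contraction_def M_def)
      also have "c k \<le> C * \<xi> ^ k"
        using C[of k] by linarith
      finally have "norm (xt k i - xc) \<le> sqrt \<gamma> * M k + C * \<xi> ^ k"
        by simp
      then have "\<beta> * norm (xt k i - xc) \<le> \<beta> * (sqrt \<gamma> * M k + C * \<xi> ^ k)"
        using \<open>\<beta> \<ge> 0\<close> by (rule mult_left_mono)
      then show ?thesis
        using gstep[OF i, of "xt k i"]
        by (simp add: gradient_step[OF i] step \<rho>_def algebra_simps)
    qed
    then show ?thesis
      unfolding R using fin regular_nonempty by (simp add: M_def[of "Suc k"])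
  qed
  have "\<rho> \<ge> 0" "0 \<le> \<xi>" "\<xi> \<noteq> \<rho>"
    using xi \<open>\<beta> \<ge> 0\<close> \<open>\<beta> * 1 \<le> \<rho>\<close> by (auto simp: \<rho>_def)
  then obtain D where D: "\<And>k. M k \<le> R_star + D * max \<rho> \<xi> ^ k"
    using perturbed_recursion_bound[OF rec] by blast

  \<comment> \<open>The distance from \<open>xc\<close> to the minimizer of the average\<close>
  define F where "F = (\<lambda>z. 1 / real (card regular) * (\<Sum>j\<in>regular. f j z))"
  define s where "s = minimizer F"
  have n: "real (card regular) > 0"
    using fin regular_nonempty by (simp add: card_gt_0_iff)
  have dF: "GDERIV F z :> (1 / real (card regular)) *\<^sub>R (\<Sum>i\<in>regular. gradient (f i) z)" for z
    unfolding F_def by (rule gradient_average[OF loc(3)])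
  then have "F differentiable (at z)" for z
    unfolding gderiv_def differentiable_def by blast
  moreover have "strongly_convex m F"
    unfolding F_def by (rule strongly_convex_average[OF fin regular_nonempty loc(3) sc])
  ultimately have "gradient F s = 0"
    unfolding s_def using \<open>m > 0\<close> by (intro gradient_eq_0_at_min strongly_convex_minimizer)
  then have "(\<Sum>i\<in>regular. gradient (f i) s) = 0"
    using gradient_eqI[OF dF, of s] n by simp
  \<comment> \<open>The local gradients cancel in the sum, so \<open>s - xc\<close> is the mean of
    vectors to each of which \<open>gstep\<close> applies.\<close>
  then have "(\<Sum>i\<in>regular. s - \<alpha> *\<^sub>R gradient (f i) s - xc) = real (card regular) *\<^sub>R (s - xc)"
    by (simp add: sum_subtractf scaleR_diff_right sum_constant_scaleR del: sum_constant
        flip: scaleR_sum_right)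
  then have "real (card regular) * norm (s - xc) = norm (\<Sum>i\<in>regular. s - \<alpha> *\<^sub>R gradient (f i) s - xc)"
    by simp
  also have "\<dots> \<le> (\<Sum>i\<in>regular. \<beta> * norm (s - xc) + r)"
    by (intro sum_norm_le gstep)
  finally have "norm (s - xc) \<le> \<beta> * norm (s - xc) + r"
    using n by simp
  \<comment> \<open>The rate is weakened from \<open>\<beta>\<close> to \<open>\<rho>\<close>, using
    \<open>1 \<le> \<gamma>\<close>, to match the denominator of \<open>R_star\<close>.\<close>
  moreover have "\<beta> * norm (s - xc) \<le> \<rho> * norm (s - xc)"
    using \<open>\<beta> * 1 \<le> \<rho>\<close> by (intro mult_right_mono) auto
  ultimately have "(1 - \<rho>) * norm (s - xc) \<le> (1 - \<rho>) * R_star"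
    unfolding R by (simp add: left_diff_distrib)
  then have s: "norm (s - xc) \<le> R_star"
    using \<open>\<rho> < 1\<close> by simp

  \<comment> \<open>The triangle inequality through \<open>xc\<close> adds the two radii. The error
    term is the same for all agents.\<close>
  have "norm (x k i - s) \<le> 2 * R_star + D * max \<rho> \<xi> ^ k" if "i \<in> regular" for i k
    using norm_triangle_ineq4[of "x k i - xc" "s - xc"] M_ge[OF that, of k] D[of k] s by simp
  moreover have "big_O_seq (\<lambda>k. D * max \<rho> \<xi> ^ k) (\<lambda>k. max \<rho> \<xi> ^ k)"
    unfolding big_O_seq_def using \<open>0 \<le> \<xi>\<close>
    \<comment> \<open>\<open>D\<close> has no known sign.\<close>
    by (intro exI[of _ "\<bar>D\<bar>"]) (simp add: abs_mult power_abs)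
  ultimately show ?thesis
    unfolding s_def F_def \<rho>_def by blast
qed

end
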